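(* Let $\dot y=f(y)$ be an ODE on $\mathbb{R}^m$ with first integrals $H_1,\dots,H_q$ ($q\ge1$), with discrete gradients $\overline{\nabla}H_1,\dots,\overline{\nabla}H_q$, and let $M=\{y\in\mathbb{R}^m:H_1(y)=c_1,\dots,H_q(y)=c_q\}$. Suppose that $\nabla H_1(y^0),\dots,\nabla H_q(y^0)$ are linearly independent for all $y^0\in M$, and that for all $y^0\in M$ the maps $y\mapsto\overline{\nabla}H_1(y^0,y),\dots,y\mapsto\overline{\nabla}H_q(y^0,y)$ are $C^\infty$. Then the local coordinates scheme, defined in the context, which advances $y^n\in M$ to $y^{n+1}$ by applying one step of any $p$th order method to the transformed ODE in the local coordinate $\eta$ and mapping back by $\chi$, is of order $p$: if $y^n=y(t)\in M$ for an exact solution $y(\cdot)$ of $\dot y=f(y)$, then one step of size $h$ gives $y^{n+1}$ with $y(t+h)-y^{n+1}=\mathcal{O}(h^{p+1})$ as $h\to0$.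
   Context: A discrete gradient of a differentiable function $H:\mathbb{R}^m\to\mathbb{R}$ is a continuous map $\overline{\nabla}H:\mathbb{R}^m\times\mathbb{R}^m\to\mathbb{R}^m$ such that for all $u,v\in\mathbb{R}^m$ $$H(u)-H(v)=\overline{\nabla}H(v,u)^{\top}(u-v),\qquad \overline{\nabla}H(u,u)=\nabla H(u).$$ A first integral of $\dot y=f(y)$ is a function constant along every solution. The vector field $f$ is assumed smooth. Coordinate map: for $y^0\in M$ and $y$ near $y^0$, let $T(y)=T(y^0,y)$ be an $m\times(m-q)$ matrix depending smoothly ($C^\infty$) on $y$, whose columns form a basis of the orthogonal complement of $\mathrm{span}\{\overline{\nabla}H_1(y^0,y),\dots,\overline{\nabla}H_q(y^0,y)\}$. The map $\eta\mapsto y=\chi(\eta)$, for $\eta\in\mathbb{R}^{m-q}$ near $0$ and $y$ near $y^0$, is defined implicitly by $$\chi(\eta)=y:\quad y-y^0=T(y^0,y)\,\eta .$$ It is a local parametrization of $M$ near $y^0$ with $\chi(0)=y^0$. Transformed ODE: writing $y(t)=\chi(\eta(t))$ and differentiating the defining relation of $\chi$ gives $\dot y=T'_{y}(\dot y)\,\eta+T(y)\,\dot\eta$, where $T'_{y}(\zeta)=\left.\frac{d}{d\varepsilon}\right|_{\varepsilon=0}T(y+\varepsilon\zeta)$ is the derivative of $y\mapsto T(y^0,y)$ at $y$ in direction $\zeta\in\mathbb{R}^m$. Inserting $\dot y=f(y)$ and solving for $\dot\eta$, the ODE on $M$ becomes $$\dot\eta=\bigl(T^{\top}T\bigr)^{-1}\Bigl(-T^{\top}\,T'_{\chi(\eta)}\bigl(f(\chi(\eta))\bigr)\,\eta+T^{\top}f(\chi(\eta))\Bigr),\qquad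 T=T(\chi(\eta)).$$ When the columns of $T$ are orthonormal, the factor $(T^{\top}T)^{-1}$ is the identity. Scheme: one step of size $h$ from $y^n\in M$ to $y^{n+1}$ is: (1) let $\eta_0=0$; (2) take one step of size $h$ from $\eta_0$ with any $p$th order method applied to the transformed ODE, with $y^0=y^n$ in the definition of $T$ and $\chi$, giving $\eta_1$; (3) set $y^{n+1}=\chi(\eta_1)$ (which is well defined for $h$ sufficiently small). A $p$th order method is a one-step method whose local error after one step of size $h$, started on an exact solution of an ODE with smooth vector field, is $\mathcal{O}(h^{p+1})$. *)

theory Defs
  imports "HOL-Analysis.Analysis" "HOL-Library.Landau_Symbols"
begin

text \<open>
  For open \<open>S\<close> in a finite-dimensional space, \<open>C_on n S f\<close> is the usual notion of \<open>f\<close> being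
  \<open>n\<close> times continuously differentiable on \<open>S\<close>: all iterated directional derivatives exist
  (as values of Frechet derivatives) and are continuous.
\<close>

fun C_on :: "nat \<Rightarrow> 'a::real_normed_vector set \<Rightarrow> ('a \<Rightarrow> 'b::real_normed_vector) \<Rightarrow> bool" where
  "C_on 0 S f \<longleftrightarrow> continuous_on S f"
| "C_on (Suc n) S f \<longleftrightarrow> (\<forall>x\<in>S. f differentiable (at x)) \<and>
     (\<forall>v. C_on n S (\<lambda>x. frechet_derivative f (at x) v))"

definition smooth_on :: "'a::real_normed_vector set \<Rightarrow> ('a \<Rightarrow> 'b::real_normed_vector) \<Rightarrow> bool" where
  "smooth_on S f \<longleftrightarrow> (\<forall>n. C_on n S f)"

definition grad :: "('a::real_inner \<Rightarrow> real) \<Rightarrow> 'a \<Rightarrow> 'a" where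
  "grad H u = (THE D. GDERIV H u :> D)"

definition discrete_gradient :: "('a::real_inner \<Rightarrow> real) \<Rightarrow> ('a \<Rightarrow> 'a \<Rightarrow> 'a) \<Rightarrow> bool" where
  "discrete_gradient H G \<longleftrightarrow>
     (\<forall>u. H differentiable (at u)) \<and>
     continuous_on UNIV (\<lambda>(v, u). G v u) \<and>
     (\<forall>u v. H u - H v = inner (G v u) (u - v)) \<and>
     (\<forall>u. G u u = grad H u)"

definition ode_solution :: "('a::real_normed_vector \<Rightarrow> 'a) \<Rightarrow> (real \<Rightarrow> 'a) \<Rightarrow> real set \<Rightarrow> bool" where
  "ode_solution f y I \<longleftrightarrow> (\<forall>s\<in>I. (y has_vector_derivative f (y s)) (at s within I))"

definition first_integral :: "('a::real_normed_vector \<Rightarrow> 'a) \<Rightarrow> ('a \<Rightarrow> real) \<Rightarrow> bool" where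
  "first_integral f H \<longleftrightarrow>
     (\<forall>y I. is_interval I \<and> ode_solution f y I \<longrightarrow> (\<lambda>s. H (y s)) constant_on I)"

definition level_set :: "nat \<Rightarrow> (nat \<Rightarrow> 'a \<Rightarrow> real) \<Rightarrow> (nat \<Rightarrow> real) \<Rightarrow> 'a set" where
  "level_set q H c = {y. \<forall>i<q. H i y = c i}"

definition independent_family :: "'i set \<Rightarrow> ('i \<Rightarrow> 'a::real_vector) \<Rightarrow> bool" where
  "independent_family I v \<longleftrightarrow> inj_on v I \<and> independent (v ` I)"

text \<open>
  A one-step method \<open>\<Phi>\<close> sends a vector field \<open>g\<close>, a step size \<open>h\<close> and a point to the next point.
  Vector fields are total functions, but the order condition concerns fields that are smooth on
  some open set \<open>U\<close> only (the transformed ODE lives on a neighbourhood of \<open>0\<close>); the solution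
  has to stay in \<open>U\<close>, and values of \<open>g\<close> off \<open>U\<close> are irrelevant. Step sizes are positive.
  As in the notion of local error at a given exact solution, the constant in the
  \<open>O\<close>-term may depend on the solution and on its starting time.
\<close>

definition method_of_order ::
  "(('a::real_normed_vector \<Rightarrow> 'a) \<Rightarrow> real \<Rightarrow> 'a \<Rightarrow> 'a) \<Rightarrow> nat \<Rightarrow> bool" where
  "method_of_order \<Phi> p \<longleftrightarrow>
     (\<forall>U g x t b. open U \<and> smooth_on U g \<and> t < b \<and> x ` {t..b} \<subseteq> U \<and> ode_solution g x {t..b} \<longrightarrow>
        (\<lambda>h. norm (x (t + h) - \<Phi> g h (x t))) \<in> O[at_right 0](\<lambda>h. h ^ (p + 1)))"

text \<open>
  Up to and including \<open>scheme_step\<close>, \<open>T\<close> stands for the matrix-valued map \<open>y \<mapsto> T(y0, y)\<close> at a fixed base point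
  \<open>y0\<close>; \<open>real ^ 'k ^ 'm\<close> has rows indexed by \<open>'m\<close> and columns indexed by \<open>'k\<close>.
\<close>

definition complement_frame ::
  "nat \<Rightarrow> (nat \<Rightarrow> real ^ 'm \<Rightarrow> real ^ 'm \<Rightarrow> real ^ 'm) \<Rightarrow> real ^ 'm \<Rightarrow>
   (real ^ 'm \<Rightarrow> real ^ 'k ^ 'm) \<Rightarrow> bool" where
  "complement_frame q G y0 T \<longleftrightarrow>
     (\<exists>W. open W \<and> y0 \<in> W \<and> smooth_on W T \<and>
        (\<forall>y\<in>W. independent_family UNIV (\<lambda>j. column j (T y)) \<and>
                span (columns (T y)) = orthogonal_comp (span ((\<lambda>i. G i y0 y) ` {..<q}))))"

text \<open>
  The implicit definition of \<open>chi\<close>: for \<open>\<eta>\<close> in the neighbourhood \<open>U\<close> of \<open>0\<close>, the point \<open>chi \<eta>\<close> is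
  the one and only solution \<open>y\<close> of \<open>y - y0 = T(y0, y) \<eta>\<close> in the neighbourhood \<open>V\<close> of \<open>y0\<close>.
\<close>

definition coordinate_map ::
  "real ^ 'm \<Rightarrow> (real ^ 'm \<Rightarrow> real ^ 'k ^ 'm) \<Rightarrow> (real ^ 'k) set \<Rightarrow> (real ^ 'm) set \<Rightarrow>
   (real ^ 'k \<Rightarrow> real ^ 'm) \<Rightarrow> bool" where
  "coordinate_map y0 T U V chi \<longleftrightarrow>
     open U \<and> 0 \<in> U \<and> open V \<and> y0 \<in> V \<and>
     (\<forall>\<eta>\<in>U. chi \<eta> \<in> V \<and> (\<forall>y\<in>V. chi \<eta> = y \<longleftrightarrow> y - y0 = T y *v \<eta>))"

definition dir_deriv ::
  "('a::real_normed_vector \<Rightarrow> 'b::real_normed_vector) \<Rightarrow> 'a \<Rightarrow> 'a \<Rightarrow> 'b" where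
  "dir_deriv T y \<zeta> = vector_derivative (\<lambda>\<epsilon>. T (y + \<epsilon> *\<^sub>R \<zeta>)) (at 0)"

definition transformed_field ::
  "(real ^ 'm \<Rightarrow> real ^ 'm) \<Rightarrow> (real ^ 'm \<Rightarrow> real ^ 'k ^ 'm) \<Rightarrow> (real ^ 'k \<Rightarrow> real ^ 'm) \<Rightarrow>
   real ^ 'k \<Rightarrow> real ^ 'k" where
  "transformed_field f T chi \<eta> =
     (let y = chi \<eta>; A = T y in
        matrix_inv (transpose A ** A) *v
          (- (transpose A *v (dir_deriv T y (f y) *v \<eta>)) + transpose A *v f y))"

definition scheme_coordinate ::
  "((real ^ 'k \<Rightarrow> real ^ 'k) \<Rightarrow> real \<Rightarrow> real ^ 'k \<Rightarrow> real ^ 'k) \<Rightarrow> (real ^ 'm \<Rightarrow> real ^ 'm) \<Rightarrow>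
   (real ^ 'm \<Rightarrow> real ^ 'k ^ 'm) \<Rightarrow> (real ^ 'k \<Rightarrow> real ^ 'm) \<Rightarrow> real \<Rightarrow> real ^ 'k" where
  "scheme_coordinate \<Phi> f T chi h = \<Phi> (transformed_field f T chi) h 0"

definition scheme_step ::
  "((real ^ 'k \<Rightarrow> real ^ 'k) \<Rightarrow> real \<Rightarrow> real ^ 'k \<Rightarrow> real ^ 'k) \<Rightarrow> (real ^ 'm \<Rightarrow> real ^ 'm) \<Rightarrow>
   (real ^ 'm \<Rightarrow> real ^ 'k ^ 'm) \<Rightarrow> (real ^ 'k \<Rightarrow> real ^ 'm) \<Rightarrow> real \<Rightarrow> real ^ 'm" where
  "scheme_step \<Phi> f T chi h = chi (scheme_coordinate \<Phi> f T chi h)"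

text \<open>
  \<open>scheme_has_order f M T \<Phi> p\<close>: around every point of \<open>M\<close> the implicit coordinate map exists,
  and for every choice of it the step from a point \<open>y t\<close> of \<open>M\<close> on an exact solution is
  well defined for small \<open>h > 0\<close> and has local error \<open>O(h ^ (p + 1))\<close>.
\<close>

definition scheme_has_order ::
  "(real ^ 'm \<Rightarrow> real ^ 'm) \<Rightarrow> (real ^ 'm) set \<Rightarrow> (real ^ 'm \<Rightarrow> real ^ 'm \<Rightarrow> real ^ 'k ^ 'm) \<Rightarrow>
   ((real ^ 'k \<Rightarrow> real ^ 'k) \<Rightarrow> real \<Rightarrow> real ^ 'k \<Rightarrow> real ^ 'k) \<Rightarrow> nat \<Rightarrow> bool" where
  "scheme_has_order f M T \<Phi> p \<longleftrightarrow>
     (\<forall>y0\<in>M. \<exists>U V chi. coordinate_map y0 (T y0) U V chi) \<and>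
     (\<forall>y t b U V chi. t < b \<and> ode_solution f y {t..b} \<and> y t \<in> M \<and>
          coordinate_map (y t) (T (y t)) U V chi \<longrightarrow>
        (\<forall>\<^sub>F h in at_right 0. scheme_coordinate \<Phi> f (T (y t)) chi h \<in> U) \<and>
        (\<lambda>h. norm (y (t + h) - scheme_step \<Phi> f (T (y t)) chi h)) \<in> O[at_right 0](\<lambda>h. h ^ (p + 1)))"

text \<open>
  The coordinate space of dimension \<open>m - q\<close> is \<open>real ^ 'k\<close>, which always has positive dimension.
  In the remaining case \<open>q = m\<close> the only coordinate is \<open>\<eta> = 0\<close>, so the defining
  relation reads \<open>chi(0) = y0\<close> and the step is \<open>y t \<mapsto> y t\<close>.
\<close>

definition trivial_scheme_has_order ::
  "(real ^ 'm \<Rightarrow> real ^ 'm) \<Rightarrow> (real ^ 'm) set \<Rightarrow> nat \<Rightarrow> bool" where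
  "trivial_scheme_has_order f M p \<longleftrightarrow>
     (\<forall>y t b. t < b \<and> ode_solution f y {t..b} \<and> y t \<in> M \<longrightarrow>
        (\<lambda>h. norm (y (t + h) - y t)) \<in> O[at_right 0](\<lambda>h. h ^ (p + 1)))"

end

theory Submission
  imports Defs
begin

text \<open>
  By the implicit function theorem \<open>chi\<close> is smooth near \<open>0\<close>, hence so is the transformed field, its
  Gram determinant being nonzero. If \<open>y\<close> is an exact solution with \<open>y t = y0\<close>, the integrals are
  constant along it, so \<open>0 = H i (y s) - H i y0 = G i y0 (y s) \<bullet> (y s - y0)\<close>: the increment
  \<open>y s - y0\<close> lies in the column space of \<open>T (y s)\<close>, and solving \<open>y s - y0 = T (y s) *v \<eta> s\<close> by least
  squares gives a differentiable \<open>\<eta>\<close> with \<open>chi (\<eta> s) = y s\<close>, which therefore solves the transformed ODE.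
  The order condition applies to \<open>\<eta>\<close>, and the Lipschitz map \<open>chi\<close> transports the error estimate
  back to \<open>y\<close>.
\<close>

section \<open>Calculus of \<open>C_on\<close>\<close>

text \<open>Openness of \<open>S\<close> makes the derivative at a point of \<open>S\<close> depend
  on values in \<open>S\<close> only. The induction passes from \<open>f\<close> and
  \<open>g\<close> to their derivatives, so both are generalised.\<close>

lemma C_on_cong:
  assumes "open S" "\<And>x. x \<in> S \<Longrightarrow> f x = g x" "C_on n S f"
  shows "C_on n S g"
  using assms(2,3)
proof (induction n arbitrary: f g)
  case 0
  then show ?case
    using continuous_on_cong[of S S f g] by simp
next
  case (Suc n)
  have D: "(g has_derivative frechet_derivative f (at x)) (at x)" if "x \<in> S" for x
    using has_derivative_transform_within_open[OF _ \<open>open S\<close> that, of f _ UNIV g] Suc.prems that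
      frechet_derivative_works by fastforce
  have "frechet_derivative f (at x) = frechet_derivative g (at x)" if "x \<in> S" for x
    by (rule frechet_derivative_at[OF D[OF that]])
  then have "C_on n S (\<lambda>x. frechet_derivative g (at x) v)" for v
    using Suc.IH[of "\<lambda>x. frechet_derivative f (at x) v" "\<lambda>x. frechet_derivative g (at x) v"]
      Suc.prems(2) by simp
  then show ?case
    using D by (auto simp: differentiable_def)
qed

text \<open>Permits an explicit derivative from the differentiation rules in place of
  \<open>frechet_derivative\<close>; the closure rules proved by induction on the order rest on
  it.\<close>

lemma C_on_SucI:
  assumes "open S" "\<And>x. x \<in> S \<Longrightarrow> (f has_derivative D x) (at x)" "\<And>v. C_on n S (\<lambda>x. D x v)"
  shows "C_on (Suc n) S f"
proof -
  have "C_on n S (\<lambda>x. frechet_derivative f (at x) v)" for v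
    by (rule C_on_cong[OF assms(1) _ assms(3)]) (simp add: frechet_derivative_at[OF assms(2)])
  then show ?thesis
    using assms(2) by (auto simp: differentiable_def)
qed

lemma C_on_SucD:
  assumes "C_on (Suc n) S f"
  shows "x \<in> S \<Longrightarrow> (f has_derivative frechet_derivative f (at x)) (at x)"
    and "C_on n S (\<lambda>x. frechet_derivative f (at x) v)"
  using assms frechet_derivative_works by auto

lemma C_on_Suc_imp: "C_on (Suc n) S f \<Longrightarrow> C_on n S f"
proof (induction n arbitrary: f)
  case 0
  then show ?case
    by (auto intro!: continuous_at_imp_continuous_on differentiable_imp_continuous_within)
qed (metis C_on.simps(2))

lemma C_on_imp_continuous: "C_on n S f \<Longrightarrow> continuous_on S f"
  by (induction n) (use C_on_Suc_imp in auto)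

lemma C_on_subset: "C_on n S f \<Longrightarrow> R \<subseteq> S \<Longrightarrow> C_on n R f"
  by (induction n arbitrary: f) (auto intro: continuous_on_subset)

lemma C_on_const [simp]: "C_on n S (\<lambda>x. c)"
  by (induction n arbitrary: c) (auto simp: frechet_derivative_const)

lemma C_on_add:
  assumes "open S" "C_on n S f" "C_on n S g"
  shows "C_on n S (\<lambda>x. f x + g x)"
  using assms(2,3)
proof (induction n arbitrary: f g)
  case (Suc n)
  show ?case
    by (rule C_on_SucI[OF \<open>open S\<close> has_derivative_add[OF C_on_SucD(1)[OF Suc.prems(1)] C_on_SucD(1)[OF Suc.prems(2)]]])
      (assumption | rule Suc.IH C_on_SucD(2)[OF Suc.prems(1)] C_on_SucD(2)[OF Suc.prems(2)])+
qed (simp add: continuous_on_add)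

lemma C_on_sum:
  assumes "open S" "\<And>i. i \<in> I \<Longrightarrow> C_on n S (f i)"
  shows "C_on n S (\<lambda>x. \<Sum>i\<in>I. f i x)"
  using assms(2) by (induction I rule: infinite_finite_induct) (auto intro: C_on_add assms(1))

lemma (in bounded_linear) C_on:
  assumes "open S" "C_on n S g"
  shows "C_on n S (\<lambda>x. f (g x))"
  using assms(2)
proof (induction n arbitrary: g)
  case 0
  then show ?case by (simp add: continuous_on)
next
  case (Suc n)
  show ?case
    by (rule C_on_SucI[OF \<open>open S\<close> has_derivative[OF C_on_SucD(1)[OF Suc.prems]]])
      (assumption | rule Suc.IH C_on_SucD(2)[OF Suc.prems])+
qed

lemma C_on_minus: "open S \<Longrightarrow> C_on n S f \<Longrightarrow> C_on n S (\<lambda>x. - f x)"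
  by (rule bounded_linear.C_on[OF bounded_linear_minus[OF bounded_linear_ident]])

lemma C_on_diff: "open S \<Longrightarrow> C_on n S f \<Longrightarrow> C_on n S g \<Longrightarrow> C_on n S (\<lambda>x. f x - g x)"
  using C_on_add[OF _ _ C_on_minus, of S n f g] by simp

lemma C_on_ident: "open S \<Longrightarrow> C_on n S (\<lambda>x. x)"
  by (cases n) (auto intro: C_on_SucI)

text \<open>The product rule yields two summands of the same bilinear shape, so the induction closes
  once the undifferentiated factor is lowered from order \<open>Suc n\<close> to
  \<open>n\<close>.\<close>

lemma (in bounded_bilinear) C_on:
  assumes "open S" "C_on n S f" "C_on n S g"
  shows "C_on n S (\<lambda>x. prod (f x) (g x))"
  using assms(2,3)
proof (induction n arbitrary: f g)
  case 0
  then show ?case by (simp add: continuous_on)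
next
  case (Suc n)
  show ?case
    by (rule C_on_SucI[OF \<open>open S\<close> FDERIV[OF C_on_SucD(1)[OF Suc.prems(1)] C_on_SucD(1)[OF Suc.prems(2)]]])
      (assumption | rule C_on_add Suc.IH C_on_SucD(2)[OF Suc.prems(1)] C_on_SucD(2)[OF Suc.prems(2)]
        C_on_Suc_imp[OF Suc.prems(1)] C_on_Suc_imp[OF Suc.prems(2)] assms(1))+
qed

lemma C_on_prod:
  fixes f :: "'i \<Rightarrow> 'a::real_normed_vector \<Rightarrow> 'b::real_normed_field"
  assumes "open S" "\<And>i. i \<in> I \<Longrightarrow> C_on n S (f i)"
  shows "C_on n S (\<lambda>x. \<Prod>i\<in>I. f i x)"
  using assms(2)
  by (induction I rule: infinite_finite_induct)
    (auto intro!: bounded_bilinear.C_on[OF bounded_bilinear_mult] assms(1))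

lemma linear_eq_sum_Basis:
  fixes f :: "'a::euclidean_space \<Rightarrow> 'b::real_vector"
  assumes "linear f"
  shows "f w = (\<Sum>b\<in>Basis. (w \<bullet> b) *\<^sub>R f b)"
proof -
  have "f w = f (\<Sum>b\<in>Basis. (w \<bullet> b) *\<^sub>R b)"
    by (simp only: euclidean_representation)
  also have "\<dots> = (\<Sum>b\<in>Basis. (w \<bullet> b) *\<^sub>R f b)"
    by (simp only: linear_sum[OF assms] linear_scale[OF assms])
  finally show ?thesis .
qed

text \<open>The chain rule differentiates \<open>f\<close> at \<open>g x\<close> in a direction that
  varies with \<open>x\<close>, whereas \<open>C_on\<close> speaks of fixed directions. Expanding
  the direction in \<open>Basis\<close> gives a finite sum of scalar factors times fixed directional
  derivatives of \<open>f\<close> at \<open>g x\<close>, and the induction hypothesis covers the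
  latter.\<close>

lemma C_on_compose:
  fixes g :: "'a::real_normed_vector \<Rightarrow> 'b::euclidean_space"
  assumes "open S" "C_on n S g" "C_on n R f" "g ` S \<subseteq> R"
  shows "C_on n S (\<lambda>x. f (g x))"
  using assms(2,3)
proof (induction n arbitrary: f)
  case 0
  then show ?case
    using assms(4) by (auto intro: continuous_on_compose2)
next
  case (Suc n)
  let ?g' = "\<lambda>x v. frechet_derivative g (at x) v"
  let ?f' = "\<lambda>y v. frechet_derivative f (at y) v"
  have "((\<lambda>x. f (g x)) has_derivative (\<lambda>v. \<Sum>b\<in>Basis. (?g' x v \<bullet> b) *\<^sub>R ?f' (g x) b)) (at x)"
    if "x \<in> S" for x
  proof -
    have f': "(f has_derivative ?f' (g x)) (at (g x))"
      using C_on_SucD(1)[OF Suc.prems(2)] that assms(4) by blast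
    have "(\<lambda>v. ?f' (g x) (?g' x v)) = (\<lambda>v. \<Sum>b\<in>Basis. (?g' x v \<bullet> b) *\<^sub>R ?f' (g x) b)"
      by (intro ext linear_eq_sum_Basis has_derivative_linear[OF f'])
    with has_derivative_compose[OF C_on_SucD(1)[OF Suc.prems(1) that] f'] show ?thesis
      by (simp only:)
  qed
  then show ?case
  proof (rule C_on_SucI[OF \<open>open S\<close>])
    fix v
    show "C_on n S (\<lambda>x. \<Sum>b\<in>Basis. (?g' x v \<bullet> b) *\<^sub>R ?f' (g x) b)"
      by (intro C_on_sum \<open>open S\<close> bounded_bilinear.C_on[OF bounded_bilinear_scaleR]
          bounded_linear.C_on[OF bounded_linear_inner_left] C_on_SucD(2)[OF Suc.prems(1)]
          Suc.IH C_on_Suc_imp[OF Suc.prems(1)] C_on_SucD(2)[OF Suc.prems(2)])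
  qed
qed

text \<open>The derivative of \<open>1/f\<close> is a product of \<open>f'\<close> with two factors
  \<open>1/f\<close>, so order \<open>n\<close> of \<open>1/f\<close> itself controls order
  \<open>Suc n\<close>.\<close>

lemma C_on_inverse:
  fixes f :: "'a::real_normed_vector \<Rightarrow> real"
  assumes "open S" "C_on n S f" "\<And>x. x \<in> S \<Longrightarrow> f x \<noteq> 0"
  shows "C_on n S (\<lambda>x. inverse (f x))"
  using assms(2)
proof (induction n)
  case 0
  then show ?case
    using assms(3) by (auto intro: continuous_on_inverse)
next
  case (Suc n)
  show ?case
    by (rule C_on_SucI[OF \<open>open S\<close> Deriv.has_derivative_inverse[OF assms(3) C_on_SucD(1)[OF Suc.prems]]])
      (auto intro!: C_on_minus bounded_bilinear.C_on[OF bounded_bilinear_mult]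
        C_on_Suc_imp[OF Suc.prems] C_on_SucD(2)[OF Suc.prems] Suc.IH assms(1))
qed

text \<open>Serves the term \<open>T'_y(f(y))\<close> of the transformed field. The moving direction
  is again expanded in \<open>Basis\<close>, and one order of \<open>f\<close> is spent on the
  derivative.\<close>

lemma C_on_derivative_apply:
  fixes f :: "'b::euclidean_space \<Rightarrow> 'c::real_normed_vector"
  assumes "open S" "C_on (Suc n) R f" "C_on n S g" "C_on n S w" "g ` S \<subseteq> R"
  shows "C_on n S (\<lambda>x. frechet_derivative f (at (g x)) (w x))"
proof -
  have "(\<Sum>b\<in>Basis. (w x \<bullet> b) *\<^sub>R frechet_derivative f (at (g x)) b)
      = frechet_derivative f (at (g x)) (w x)" if "x \<in> S" for x
    using linear_eq_sum_Basis[OF has_derivative_linear[OF C_on_SucD(1)[OF assms(2)]]] that assms(5)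
    by (metis image_subset_iff)
  moreover have "C_on n S (\<lambda>x. \<Sum>b\<in>Basis. (w x \<bullet> b) *\<^sub>R frechet_derivative f (at (g x)) b)"
    by (intro C_on_sum bounded_bilinear.C_on[OF bounded_bilinear_scaleR] assms(1,4)
        bounded_linear.C_on[OF bounded_linear_inner_left]
        C_on_compose[OF assms(1,3) C_on_SucD(2)[OF assms(2)] assms(5)])
  ultimately show ?thesis
    by (rule C_on_cong[OF assms(1)])
qed

text \<open>On the compact ball the sum of the norms of the partial derivatives is bounded, and it
  dominates the operator norm; the mean value inequality on the convex ball does the rest.\<close>

lemma C_on_1_lipschitz_cball:
  fixes f :: "'a::euclidean_space \<Rightarrow> 'b::real_normed_vector"
  assumes "C_on 1 S f" "cball a r \<subseteq> S"
  obtains C where "\<And>x y. x \<in> cball a r \<Longrightarrow> y \<in> cball a r \<Longrightarrow> norm (f x - f y) \<le> C * norm (x - y)"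
proof -
  let ?D = "\<lambda>x. frechet_derivative f (at x)"
  have f': "(f has_derivative ?D x) (at x)" if "x \<in> cball a r" for x
    using C_on_SucD(1)[of 0 S f] assms that by auto
  have "continuous_on (cball a r) (\<lambda>x. ?D x v)" for v
    using C_on_SucD(2)[of 0 S f] assms by (auto intro: continuous_on_subset)
  then have "compact ((\<lambda>x. \<Sum>b\<in>Basis. norm (?D x b)) ` cball a r)"
    by (intro compact_continuous_image continuous_intros compact_cball)
  then obtain C where C: "\<And>x. x \<in> cball a r \<Longrightarrow> (\<Sum>b\<in>Basis. norm (?D x b)) \<le> C"
    by (meson bounded_imp_bdd_above bdd_above.E compact_imp_bounded imageI)
  have "onorm (?D x) \<le> C" if "x \<in> cball a r" for x
  proof (rule onorm_le)
    fix w
    have "norm (?D x w) = norm (\<Sum>b\<in>Basis. (w \<bullet> b) *\<^sub>R ?D x b)"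
      using linear_eq_sum_Basis[OF has_derivative_linear[OF f'[OF that]], of w] by (rule arg_cong)
    also have "\<dots> \<le> (\<Sum>b\<in>Basis. norm w * norm (?D x b))"
      by (intro order_trans[OF norm_sum] sum_mono) (simp add: mult_right_mono Basis_le_norm)
    also have "\<dots> = (\<Sum>b\<in>Basis. norm (?D x b)) * norm w"
      by (simp add: sum_distrib_left[symmetric])
    also have "\<dots> \<le> C * norm w"
      by (intro mult_right_mono C that) simp
    finally show "norm (?D x w) \<le> C * norm w" .
  qed
  then have "norm (f x - f y) \<le> C * norm (x - y)" if "x \<in> cball a r" "y \<in> cball a r" for x y
    using differentiable_bound[OF convex_cball[of a r] has_derivative_at_withinI[OF f'], of C x y] that by auto
  then show ?thesis
    using that by blast
qed

section \<open>Matrix-valued maps\<close>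

lemma bounded_bilinear_matrix_vector_mult:
  "bounded_bilinear ((*v) :: real ^ 'n ^ 'm \<Rightarrow> real ^ 'n \<Rightarrow> real ^ 'm)"
  unfolding bilinear_conv_bounded_bilinear[symmetric] bilinear_def
  by (auto intro!: linearI simp: matrix_vector_mult_add_rdistrib matrix_vector_right_distrib
      scaleR_matrix_vector_assoc matrix_vector_mult_scaleR)

lemma bounded_bilinear_matrix_matrix_mult:
  "bounded_bilinear ((**) :: real ^ 'n ^ 'm \<Rightarrow> real ^ 'p ^ 'n \<Rightarrow> real ^ 'p ^ 'm)"
  unfolding bilinear_conv_bounded_bilinear[symmetric] bilinear_def
  by (auto intro!: linearI simp: vec_eq_iff matrix_matrix_mult_def sum.distrib sum_distrib_left
      algebra_simps)

lemma bounded_linear_transpose: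
  "bounded_linear (transpose :: real ^ 'n ^ 'm \<Rightarrow> real ^ 'm ^ 'n)"
  unfolding linear_conv_bounded_linear[symmetric]
  by (auto intro!: linearI simp: vec_eq_iff transpose_def)

lemma C_on_vec:
  fixes f :: "'a::real_normed_vector \<Rightarrow> 'b::euclidean_space ^ 'n"
  assumes "open S" "\<And>i. C_on n S (\<lambda>x. f x $ i)"
  shows "C_on n S f"
proof -
  have lin: "bounded_linear (axis i :: 'b \<Rightarrow> 'b ^ 'n)" for i
    unfolding linear_conv_bounded_linear[symmetric]
    by (auto intro!: linearI simp: vec_eq_iff axis_def)
  have "C_on n S (\<lambda>x. \<Sum>i\<in>UNIV. axis i (f x $ i))"
    by (intro C_on_sum bounded_linear.C_on[OF lin] assms)
  moreover have "(\<Sum>i\<in>UNIV. axis i (f x $ i)) = f x" for x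
    by (simp add: vec_eq_iff axis_def)
  ultimately show ?thesis
    by simp
qed

lemma C_on_vec_nth: "open S \<Longrightarrow> C_on n S f \<Longrightarrow> C_on n S (\<lambda>x. f x $ i)"
  by (rule bounded_linear.C_on[OF bounded_linear_vec_nth])

lemma C_on_det:
  fixes A :: "'a::real_normed_vector \<Rightarrow> real ^ 'n ^ 'n"
  assumes "open S" "C_on n S A"
  shows "C_on n S (\<lambda>x. det (A x))"
  unfolding det_def
  by (intro C_on_sum C_on_prod bounded_bilinear.C_on[OF bounded_bilinear_mult] C_on_const
      C_on_vec_nth assms)

lemma matrix_inv_mult:
  fixes A :: "real ^ 'n ^ 'n"
  assumes "det A \<noteq> 0"
  shows "matrix_inv A ** A = mat 1" "A ** matrix_inv A = mat 1"
  using someI_ex[of "\<lambda>B. A ** B = mat 1 \<and> B ** A = mat 1"] assms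
  by (auto simp: matrix_inv_def invertible_def invertible_det_nz[symmetric])

lemma matrix_inv_mult_vector_eq_iff:
  fixes A :: "real ^ 'n ^ 'n"
  assumes "det A \<noteq> 0"
  shows "matrix_inv A *v b = x \<longleftrightarrow> A *v x = b"
  by (metis assms matrix_inv_mult matrix_vector_mul_assoc matrix_vector_mul_lid)

text \<open>By Cramer's rule each component is a quotient of two determinants, that is, of
  polynomials in the entries of \<open>A x\<close> and \<open>b x\<close> with nonvanishing
  denominator.\<close>

lemma C_on_matrix_inv_mult:
  fixes A :: "'a::real_normed_vector \<Rightarrow> real ^ 'n ^ 'n" and b :: "'a \<Rightarrow> real ^ 'n"
  assumes "open S" "C_on n S A" "C_on n S b" "\<And>x. x \<in> S \<Longrightarrow> det (A x) \<noteq> 0"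
  shows "C_on n S (\<lambda>x. matrix_inv (A x) *v b x)"
proof -
  have "C_on n S (\<lambda>x. if j = k then b x $ i else A x $ i $ j)" for i j k
    using assms by (cases "j = k") (simp_all add: C_on_vec_nth)
  then have "C_on n S (\<lambda>x. (\<chi> i j. if j = k then b x $ i else A x $ i $ j) :: real ^ 'n ^ 'n)" for k
    by (intro C_on_vec \<open>open S\<close>) simp
  then have "C_on n S (\<lambda>x. \<chi> k. det (\<chi> i j. if j = k then b x $ i else A x $ i $ j) * inverse (det (A x)))"
    by (intro C_on_vec \<open>open S\<close>)
      (auto intro!: bounded_bilinear.C_on[OF bounded_bilinear_mult] C_on_det C_on_inverse assms)
  moreover have "(\<chi> k. det (\<chi> i j. if j = k then b x $ i else A x $ i $ j) * inverse (det (A x)))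
      = matrix_inv (A x) *v b x" if "x \<in> S" for x
  proof -
    have "A x *v (matrix_inv (A x) *v b x) = b x"
      using matrix_inv_mult_vector_eq_iff[OF assms(4)[OF that]] by blast
    then show ?thesis
      unfolding cramer[OF assms(4)[OF that]] divide_inverse by (rule sym)
  qed
  ultimately show ?thesis
    by (rule C_on_cong[OF \<open>open S\<close>, rotated])
qed

section \<open>The coordinate map\<close>

text \<open>
  The implicit function theorem for \<open>y - y0 - T y *v \<eta> = 0\<close> is the inverse function theorem for
  \<open>(\<eta>, y) \<mapsto> (\<eta>, y - T y *v \<eta>)\<close>; bijectivity of its derivative is the last conclusion.
\<close>

lemma coordinate_map_differentiable:
  fixes T :: "real ^ 'm \<Rightarrow> real ^ 'k ^ 'm"
  assumes "open W" "y0 \<in> W" "C_on 1 W T"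
  obtains U V chi where "coordinate_map y0 T U V chi" "V \<subseteq> W"
    "\<And>\<eta>. \<eta> \<in> U \<Longrightarrow> chi differentiable (at \<eta>)"
    "\<And>\<eta> w. \<eta> \<in> U \<Longrightarrow> w = frechet_derivative T (at (chi \<eta>)) w *v \<eta> \<Longrightarrow> w = 0"
proof -
  let ?D = "\<lambda>y. frechet_derivative T (at y)"
  have T': "(T has_derivative ?D y) (at y)" if "y \<in> W" for y
    using C_on_SucD(1)[of 0 W T] assms(3) that by simp
  have contD: "continuous_on W (\<lambda>y. ?D y w)" for w
    using C_on_SucD(2)[of 0 W T] assms(3) by simp
  have contT: "continuous_on W T"
    using C_on_imp_continuous assms(3) by blast
  interpret mv: bounded_bilinear "(*v) :: real ^ 'k ^ 'm \<Rightarrow> real ^ 'k \<Rightarrow> real ^ 'm"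
    by (rule bounded_bilinear_matrix_vector_mult)
  define \<Psi> :: "(real ^ 'k) \<times> (real ^ 'm) \<Rightarrow> (real ^ 'k) \<times> (real ^ 'm)"
    where "\<Psi> z = (fst z, snd z - T (snd z) *v fst z)" for z
  define \<Psi>' where "\<Psi>' z w = (fst w, snd w - (T (snd z) *v fst w + ?D (snd z) (snd w) *v fst z))"
    for z w :: "(real ^ 'k) \<times> (real ^ 'm)"
  have der: "(\<Psi> has_derivative \<Psi>' z) (at z)" if "z \<in> UNIV \<times> W" for z
  proof -
    have "((\<lambda>z. T (snd z)) has_derivative (\<lambda>w. ?D (snd z) (snd w))) (at z)"
      using that by (intro has_derivative_compose[OF has_derivative_snd[OF has_derivative_ident]] T') auto
    then show ?thesis
      unfolding \<Psi>_def[abs_def] \<Psi>'_def[abs_def]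
      by (intro has_derivative_Pair has_derivative_diff mv.FDERIV has_derivative_fst has_derivative_snd
          has_derivative_ident)
  qed
  have app: "blinfun_apply (Blinfun (\<Psi>' z)) = \<Psi>' z" if "z \<in> UNIV \<times> W" for z
    by (rule bounded_linear_Blinfun_apply[OF has_derivative_bounded_linear[OF der[OF that]]])
  have cont: "continuous_on (UNIV \<times> W) (\<lambda>z. Blinfun (\<Psi>' z))"
  proof (rule continuous_on_blinfun_componentwise)
    fix i :: "(real ^ 'k) \<times> (real ^ 'm)"
    have "continuous_on (UNIV \<times> W) (\<lambda>z. \<Psi>' z i)"
      unfolding \<Psi>'_def
      by (intro continuous_intros mv.continuous_on continuous_on_compose2[OF contT]
          continuous_on_compose2[OF contD]) auto
    then show "continuous_on (UNIV \<times> W) (\<lambda>z. blinfun_apply (Blinfun (\<Psi>' z)) i)"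
      by (simp add: app cong: continuous_on_cong)
  qed
  \<comment> \<open>\<open>L\<close> inverts \<open>\<Psi>'\<close> at \<open>(0, y0)\<close>: there
    the term with the derivative of \<open>T\<close> is multiplied by \<open>\<eta> = 0\<close>,
    which leaves only the shear by \<open>T y0\<close>.\<close>
  define L where "L w = (fst w, snd w + T y0 *v fst w)" for w :: "(real ^ 'k) \<times> (real ^ 'm)"
  have "bounded_linear L"
    unfolding L_def by (intro bounded_linear_intros mv.bounded_linear_right[THEN bounded_linear_compose])
  have inv: "Blinfun L o\<^sub>L Blinfun (\<Psi>' (0, y0)) = id_blinfun"
    using assms(2)
    by (intro blinfun_eqI)
      (simp add: app bounded_linear_Blinfun_apply[OF \<open>bounded_linear L\<close>] L_def \<Psi>'_def mv.zero_right)
  have open_UW: "open (UNIV \<times> W)" and mem_UW: "(0, y0) \<in> UNIV \<times> W"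
    using assms by (auto intro: open_Times)
  have derB: "(\<Psi> has_derivative blinfun_apply (Blinfun (\<Psi>' z))) (at z)" if "z \<in> UNIV \<times> W" for z
    using der[OF that] by (simp only: app[OF that])
  obtain Z Z' g g' where Z: "open Z" "Z \<subseteq> UNIV \<times> W" "(0, y0) \<in> Z" "open Z'" "\<Psi> (0, y0) \<in> Z'"
    and hom: "homeomorphism Z Z' \<Psi> g"
    and g': "\<And>z. z \<in> Z' \<Longrightarrow> (g has_derivative g' z) (at z)"
    and bij: "\<And>z. z \<in> Z' \<Longrightarrow> bij (blinfun_apply (Blinfun (\<Psi>' (g z))))"
    by (rule inverse_function_theorem[OF open_UW derB cont mem_UW inv]) (assumption, rule that)
  obtain A V where AV: "open A" "open V" "0 \<in> A" "y0 \<in> V" "A \<times> V \<subseteq> Z"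
    by (rule open_prod_elim[OF Z(1,3)]) (use that in simp)
  \<comment> \<open>The relation \<open>\<Psi> (\<eta>, y) = (\<eta>, y0)\<close> is the defining
    equation of the coordinate map, so its solution is the second component of the local inverse at
    \<open>(\<eta>, y0)\<close>.\<close>
  define chi where "chi \<eta> = snd (g (\<eta>, y0))" for \<eta>
  define N where "N = (\<lambda>\<eta>. (\<eta>, y0)) -` Z'"
  \<comment> \<open>\<open>A\<close> places \<open>(\<eta>, y)\<close> with \<open>y\<close> in
    \<open>V\<close> inside \<open>Z\<close>, where \<open>\<Psi>\<close> is injective: uniqueness.
    \<open>N\<close> makes the local inverse available at \<open>(\<eta>, y0)\<close>: existence.
    The preimage of \<open>V\<close> keeps the solution in \<open>V\<close>.\<close>
  define U where "U = A \<inter> (N \<inter> chi -` V)"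
  have "open N"
    unfolding N_def by (intro open_vimage Z continuous_intros)
  have diff: "chi differentiable (at \<eta>)" if "\<eta> \<in> N" for \<eta>
  proof -
    have "((\<lambda>\<eta>. g (\<eta>, y0)) has_derivative (\<lambda>v. g' (\<eta>, y0) (v, 0))) (at \<eta>)"
      using that
      by (intro has_derivative_compose[OF has_derivative_Pair[OF has_derivative_ident has_derivative_const]] g')
        (auto simp: N_def)
    then show ?thesis
      unfolding chi_def[abs_def] by (auto intro!: differentiableI has_derivative_snd)
  qed
  have "open U"
    unfolding U_def
    by (intro open_Int AV continuous_open_preimage continuous_at_imp_continuous_on
        differentiable_imp_continuous_within ballI diff \<open>open N\<close>)
  have g0: "g (0, y0) = (0, y0)"
    using homeomorphism_apply1[OF hom Z(3)] by (simp add: \<Psi>_def mv.zero_right)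
  have "0 \<in> U"
    using AV Z g0 by (simp add: U_def N_def chi_def \<Psi>_def mv.zero_right)
  have gU: "g (\<eta>, y0) = (\<eta>, chi \<eta>)" "chi \<eta> - y0 = T (chi \<eta>) *v \<eta>" if "\<eta> \<in> U" for \<eta>
  proof -
    have "\<Psi> (g (\<eta>, y0)) = (\<eta>, y0)"
      using homeomorphism_apply2[OF hom] that by (simp add: U_def N_def)
    then show "g (\<eta>, y0) = (\<eta>, chi \<eta>)" "chi \<eta> - y0 = T (chi \<eta>) *v \<eta>"
      by (auto simp: \<Psi>_def chi_def prod_eq_iff algebra_simps)
  qed
  have "y = chi \<eta>" if "\<eta> \<in> U" "y \<in> V" "y - y0 = T y *v \<eta>" for \<eta> y
  proof -
    have "(\<eta>, y) \<in> Z"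
      using that AV by (auto simp: U_def)
    moreover have "\<Psi> (\<eta>, y) = (\<eta>, y0)"
      using that by (auto simp: \<Psi>_def algebra_simps)
    ultimately show ?thesis
      using homeomorphism_apply1[OF hom, of "(\<eta>, y)"] by (simp add: chi_def)
  qed
  then have "coordinate_map y0 T U V chi"
    unfolding coordinate_map_def using \<open>open U\<close> \<open>0 \<in> U\<close> AV gU(2) by (auto simp: U_def)
  moreover have "V \<subseteq> W"
    using AV Z by auto
  moreover have "w = 0" if "\<eta> \<in> U" "w = ?D (chi \<eta>) w *v \<eta>" for \<eta> w
  proof -
    have z: "(\<eta>, y0) \<in> Z'" "(\<eta>, chi \<eta>) \<in> UNIV \<times> W"
      using that AV Z by (auto simp: U_def N_def)
    have "inj (\<Psi>' (\<eta>, chi \<eta>))"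
      using bij[OF z(1)] gU(1)[OF that(1)] app[OF z(2)] by (simp add: bij_is_inj)
    moreover have "linear (\<Psi>' (\<eta>, chi \<eta>))"
      using der[OF z(2)] has_derivative_linear by blast
    \<comment> \<open>A vector \<open>w\<close> with the assumed property yields the kernel element
      \<open>(0, w)\<close> of the injective derivative.\<close>
    moreover have "\<Psi>' (\<eta>, chi \<eta>) (0, w) = 0"
      using that by (simp add: \<Psi>'_def mv.zero_right zero_prod_def)
    ultimately show "w = 0"
      by (metis linear_injective_0 snd_conv snd_zero)
  qed
  moreover have "chi differentiable (at \<eta>)" if "\<eta> \<in> U" for \<eta>
    using that diff by (simp add: U_def)
  ultimately show ?thesis
    using that by blast
qed

text \<open>Bootstrapping: differentiating \<open>chi \<eta> = y0 + T (chi \<eta>) *v \<eta>\<close>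
  gives a linear system for the derivative of \<open>chi\<close>, whose matrix
  \<open>B \<eta>\<close> is invertible by \<open>ker\<close>. The system involves only
  \<open>\<eta>\<close>, \<open>chi\<close>, \<open>T\<close> and first derivatives of
  \<open>T\<close>; so if \<open>chi\<close> has order \<open>n\<close> and \<open>T\<close> order
  \<open>Suc n\<close>, its solution has order \<open>n\<close>.\<close>

lemma C_on_coordinate_map:
  fixes T :: "real ^ 'm \<Rightarrow> real ^ 'k ^ 'm"
  assumes "open W" "C_on n W T" "coordinate_map y0 T U V chi" "V \<subseteq> W"
    and diff: "\<And>\<eta>. \<eta> \<in> U \<Longrightarrow> chi differentiable (at \<eta>)"
    and ker: "\<And>\<eta> w. \<eta> \<in> U \<Longrightarrow> w = frechet_derivative T (at (chi \<eta>)) w *v \<eta> \<Longrightarrow> w = 0"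
  shows "C_on n U chi"
  using assms(2)
proof (induction n)
  case 0
  show ?case
    by (auto intro!: continuous_at_imp_continuous_on differentiable_imp_continuous_within diff)
next
  case (Suc n)
  let ?D = "\<lambda>y. frechet_derivative T (at y)"
  have U: "open U" "chi ` U \<subseteq> W" "\<And>\<eta>. \<eta> \<in> U \<Longrightarrow> chi \<eta> - y0 = T (chi \<eta>) *v \<eta>"
    using assms(3,4) by (auto simp: coordinate_map_def)
  have IH: "C_on n U chi"
    by (rule Suc.IH[OF C_on_Suc_imp[OF Suc.prems]])
  have T': "(T has_derivative ?D (chi \<eta>)) (at (chi \<eta>))" if "\<eta> \<in> U" for \<eta>
    using C_on_SucD(1)[OF Suc.prems] that U(2) by auto
  interpret mv: bounded_bilinear "(*v) :: real ^ 'k ^ 'm \<Rightarrow> real ^ 'k \<Rightarrow> real ^ 'm"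
    by (rule bounded_bilinear_matrix_vector_mult)
  define B where "B \<eta> = matrix (\<lambda>w. w - ?D (chi \<eta>) w *v \<eta>)" for \<eta>
  have B: "B \<eta> *v w = w - ?D (chi \<eta>) w *v \<eta>" if "\<eta> \<in> U" for \<eta> w
  proof -
    have "linear (\<lambda>w. w - ?D (chi \<eta>) w *v \<eta>)"
      using has_derivative_bounded_linear[OF T'[OF that]]
      by (intro bounded_linear.linear bounded_linear_sub bounded_linear_ident
          bounded_linear_compose[OF mv.bounded_linear_left])
    then show ?thesis
      by (simp add: B_def matrix_works)
  qed
  have det: "det (B \<eta>) \<noteq> 0" if "\<eta> \<in> U" for \<eta>
    unfolding invertible_det_nz[symmetric] invertible_left_inverse matrix_left_invertible_ker
    using ker[OF that] B[OF that] by simp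
  have TC: "C_on n U (\<lambda>\<eta>. T (chi \<eta>))" "C_on n U (\<lambda>\<eta>. ?D (chi \<eta>) w)" for w
    by (rule C_on_compose[OF U(1) IH _ U(2)] C_on_Suc_imp[OF Suc.prems] C_on_SucD(2)[OF Suc.prems])+
  have "C_on n U (\<lambda>\<eta>. B \<eta>)"
    unfolding B_def matrix_def
    by (intro C_on_vec U(1), simp only: vec_lambda_beta)
      (intro C_on_vec_nth C_on_diff mv.C_on TC C_on_const C_on_ident U(1))
  then have C: "C_on n U (\<lambda>\<eta>. matrix_inv (B \<eta>) *v (T (chi \<eta>) *v v))" for v
    by (intro C_on_matrix_inv_mult mv.C_on TC C_on_const U(1) det)
  have "matrix_inv (B \<eta>) *v (T (chi \<eta>) *v v) = frechet_derivative chi (at \<eta>) v" if "\<eta> \<in> U" for \<eta> v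
  proof -
    let ?c = "frechet_derivative chi (at \<eta>)"
    have c: "(chi has_derivative ?c) (at \<eta>)"
      using diff[OF that] frechet_derivative_works by blast
    have "((\<lambda>\<eta>. y0 + T (chi \<eta>) *v \<eta>) has_derivative (\<lambda>v. 0 + (T (chi \<eta>) *v v + ?D (chi \<eta>) (?c v) *v \<eta>))) (at \<eta>)"
      by (intro has_derivative_add has_derivative_const mv.FDERIV has_derivative_ident
          has_derivative_compose[OF c T'[OF that]])
    then have "(chi has_derivative (\<lambda>v. 0 + (T (chi \<eta>) *v v + ?D (chi \<eta>) (?c v) *v \<eta>))) (at \<eta>)"
      by (rule has_derivative_transform_within_open[OF _ U(1) that]) (metis U(3) add.commute diff_add_cancel)
    then have "?c = (\<lambda>v. 0 + (T (chi \<eta>) *v v + ?D (chi \<eta>) (?c v) *v \<eta>))"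
      using has_derivative_unique[OF c] by blast
    from fun_cong[OF this, of v] have "?c v = T (chi \<eta>) *v v + ?D (chi \<eta>) (?c v) *v \<eta>"
      unfolding add_0 .
    then have "B \<eta> *v ?c v = T (chi \<eta>) *v v"
      unfolding B[OF that] diff_eq_eq .
    then show ?thesis
      using matrix_inv_mult_vector_eq_iff[OF det[OF that]] by blast
  qed
  then have "C_on n U (\<lambda>\<eta>. frechet_derivative chi (at \<eta>) v)" for v
    using C_on_cong[OF U(1) _ C] by simp
  then show ?case
    using diff by simp
qed

section \<open>The transformed ODE\<close>

lemma dir_deriv_eq_frechet:
  assumes "(T has_derivative T') (at y)"
  shows "dir_deriv T y \<zeta> = T' \<zeta>"
proof -
  have "((\<lambda>\<epsilon>::real. y + \<epsilon> *\<^sub>R \<zeta>) has_derivative (\<lambda>\<epsilon>. \<epsilon> *\<^sub>R \<zeta>)) (at 0)"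
    by (auto intro!: derivative_eq_intros)
  then have "((\<lambda>\<epsilon>::real. T (y + \<epsilon> *\<^sub>R \<zeta>)) has_derivative (\<lambda>\<epsilon>. T' (\<epsilon> *\<^sub>R \<zeta>))) (at 0)"
    by (rule has_derivative_compose) (use assms in simp)
  then show ?thesis
    unfolding dir_deriv_def
    by (intro vector_derivative_at)
      (simp add: has_vector_derivative_def linear_scale[OF has_derivative_linear[OF assms]])
qed

text \<open>The inner product of \<open>x\<close> with the Gram matrix applied to \<open>x\<close>
  is the squared norm of \<open>A *v x\<close>, so a kernel vector of the Gram matrix is one of
  \<open>A\<close>, and independence of the columns makes it zero.\<close>

lemma gram_det_nonzero:
  fixes A :: "real ^ 'k ^ 'm"
  assumes "independent_family UNIV (\<lambda>j. column j A)"
  shows "det (transpose A ** A) \<noteq> 0"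
proof -
  have ker: "x = 0" if "A *v x = 0" for x
  proof -
    let ?c = "\<lambda>j. column j A"
    have inj: "inj ?c" and ind: "independent (range ?c)"
      using assms by (auto simp: independent_family_def)
    \<comment> \<open>Independence concerns the set of columns, so the coefficients have to be
      indexed by vectors; injectivity lets \<open>inv ?c\<close> recover the column index.\<close>
    have "(\<Sum>v\<in>range ?c. x $ inv ?c v *\<^sub>R v) = A *v x"
      by (simp add: matrix_mult_sum sum.reindex[OF inj] inv_f_f[OF inj] scalar_mult_eq_scaleR)
    then have "x $ inv ?c (?c j) = 0" for j
      using real_vector.independentD[OF ind, of "range ?c" "\<lambda>v. x $ inv ?c v"] that by simp
    then show ?thesis
      by (simp add: inv_f_f[OF inj] vec_eq_iff)
  qed
  have "x = 0" if "(transpose A ** A) *v x = 0" for x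
  proof (rule ker)
    have "(A *v x) \<bullet> (A *v x) = x \<bullet> (transpose A *v (A *v x))"
      by (metis dot_lmul_matrix vector_transpose_matrix)
    then show "A *v x = 0"
      using that by (simp add: matrix_vector_mul_assoc)
  qed
  then show ?thesis
    by (simp add: invertible_det_nz[symmetric] invertible_left_inverse matrix_left_invertible_ker)
qed

lemma gram_solve:
  fixes A :: "real ^ 'k ^ 'm"
  assumes "det (transpose A ** A) \<noteq> 0"
  shows "matrix_inv (transpose A ** A) *v (transpose A *v (A *v x)) = x"
  by (simp add: matrix_inv_mult(1)[OF assms] matrix_vector_mul_assoc)

text \<open>The matrix applied to \<open>w\<close> is the orthogonal projector onto the column
  space, which fixes the vectors of that space.\<close>

lemma gram_solve_span_columns:
  fixes A :: "real ^ 'k ^ 'm"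
  assumes "det (transpose A ** A) \<noteq> 0" "w \<in> span (columns A)"
  shows "A *v (matrix_inv (transpose A ** A) *v (transpose A *v w)) = w"
proof -
  have "span (columns A) = (*v) A ` span (range (\<lambda>i. axis i 1))"
    unfolding columns_image_basis by (rule linear_span_image) simp
  then obtain x where "w = A *v x"
    using assms(2) by auto
  then show ?thesis
    using gram_solve[OF assms(1)] by simp
qed

text \<open>The field contains a derivative of \<open>T\<close>, so its order \<open>n\<close> uses
  order \<open>Suc n\<close> of \<open>T\<close>; the inverse Gram matrix is covered by Cramer's
  rule.\<close>

lemma smooth_on_transformed_field:
  assumes "smooth_on UNIV f" "open U" "smooth_on U chi" "chi ` U \<subseteq> W" "smooth_on W T"
    and det: "\<And>y. y \<in> W \<Longrightarrow> det (transpose (T y) ** T y) \<noteq> 0"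
  shows "smooth_on U (transformed_field f T chi)"
  unfolding smooth_on_def
proof
  fix n
  let ?D = "\<lambda>y. frechet_derivative T (at y)"
  have C: "C_on n UNIV f" "C_on n U chi" "C_on n W T" "C_on (Suc n) W T"
    using assms(1,3,5) unfolding smooth_on_def by blast+
  have fc: "C_on n U (\<lambda>\<eta>. f (chi \<eta>))" and Tc: "C_on n U (\<lambda>\<eta>. T (chi \<eta>))"
    by (rule C_on_compose[OF assms(2) C(2) C(1)] C_on_compose[OF assms(2) C(2) C(3)], use assms in simp)+
  have Dc: "C_on n U (\<lambda>\<eta>. ?D (chi \<eta>) (f (chi \<eta>)))"
    by (rule C_on_derivative_apply[OF assms(2) C(4) C(2) fc assms(4)])
  have "C_on n U (\<lambda>\<eta>. matrix_inv (transpose (T (chi \<eta>)) ** T (chi \<eta>)) *v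
      (- (transpose (T (chi \<eta>)) *v (?D (chi \<eta>) (f (chi \<eta>)) *v \<eta>))
        + transpose (T (chi \<eta>)) *v f (chi \<eta>)))"
    by (intro C_on_matrix_inv_mult C_on_add C_on_minus C_on_ident assms(2) Tc Dc fc
        bounded_linear.C_on[OF bounded_linear_transpose]
        bounded_bilinear.C_on[OF bounded_bilinear_matrix_vector_mult]
        bounded_bilinear.C_on[OF bounded_bilinear_matrix_matrix_mult])
      (use det assms(4) in blast)
  then show "C_on n U (transformed_field f T chi)"
    by (rule C_on_cong[OF assms(2), rotated])
      (use assms(4) in \<open>simp add: transformed_field_def Let_def image_subset_iff
        dir_deriv_eq_frechet[OF C_on_SucD(1)[OF C(4)]]\<close>)
qed

text \<open>Serves to recognise a curve as a solution of the transformed ODE: \<open>eq\<close> is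
  the differentiated defining relation, and the left inverse of the frame extracts
  \<open>\<eta>'\<close> from it.\<close>

lemma transformed_field_eq:
  assumes det: "det (transpose (T (chi \<eta>)) ** T (chi \<eta>)) \<noteq> 0"
    and T': "(T has_derivative T') (at (chi \<eta>))"
    and eq: "f (chi \<eta>) = T (chi \<eta>) *v \<eta>' + T' (f (chi \<eta>)) *v \<eta>"
  shows "transformed_field f T chi \<eta> = \<eta>'"
proof -
  let ?A = "T (chi \<eta>)"
  have "- (transpose ?A *v (T' (f (chi \<eta>)) *v \<eta>)) + transpose ?A *v f (chi \<eta>)
      = transpose ?A *v (f (chi \<eta>) - T' (f (chi \<eta>)) *v \<eta>)"
    by (simp add: matrix_vector_mult_diff_distrib)
  also have "f (chi \<eta>) - T' (f (chi \<eta>)) *v \<eta> = ?A *v \<eta>'"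
    using eq by (metis add_diff_cancel_right')
  finally show ?thesis
    unfolding transformed_field_def Let_def dir_deriv_eq_frechet[OF T']
    by (simp only: gram_solve[OF det])
qed

section \<open>The local error of the scheme\<close>

text \<open>\<open>coordinate_map\<close> demands no regularity of \<open>chi\<close>. The implicit
  function theorem supplies a smooth \<open>chi1\<close>, and the uniqueness clause forces the two
  to agree near \<open>0\<close>.\<close>

lemma smooth_coordinate_map_near_0:
  fixes T :: "real ^ 'm \<Rightarrow> real ^ 'k ^ 'm"
  assumes "open W" "y0 \<in> W" "smooth_on W T" "coordinate_map y0 T U V chi"
  obtains N where "open N" "0 \<in> N" "N \<subseteq> U" "chi ` N \<subseteq> W" "smooth_on N chi"
proof -
  have "C_on 1 W T"
    using assms(3) by (simp only: smooth_on_def)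
  then obtain U1 V1 chi1 where cm: "coordinate_map y0 T U1 V1 chi1" and "V1 \<subseteq> W"
    and diff: "\<And>\<eta>. \<eta> \<in> U1 \<Longrightarrow> chi1 differentiable (at \<eta>)"
    and ker: "\<And>\<eta> w. \<eta> \<in> U1 \<Longrightarrow> w = frechet_derivative T (at (chi1 \<eta>)) w *v \<eta> \<Longrightarrow> w = 0"
    using coordinate_map_differentiable[OF assms(1,2)] by blast
  have C1: "C_on n U1 chi1" for n
    using C_on_coordinate_map[OF assms(1) _ cm \<open>V1 \<subseteq> W\<close> diff ker] assms(3)
    by (simp add: smooth_on_def)
  have U: "open U" "0 \<in> U" "open V" "y0 \<in> V"
    and U_eq: "\<And>\<eta> y. \<eta> \<in> U \<Longrightarrow> y \<in> V \<Longrightarrow> chi \<eta> = y \<longleftrightarrow> y - y0 = T y *v \<eta>"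
    using assms(4) by (auto simp: coordinate_map_def)
  have U1: "open U1" "0 \<in> U1" "y0 \<in> V1" "\<And>\<eta>. \<eta> \<in> U1 \<Longrightarrow> chi1 \<eta> \<in> V1"
    and U1_eq: "\<And>\<eta> y. \<eta> \<in> U1 \<Longrightarrow> y \<in> V1 \<Longrightarrow> chi1 \<eta> = y \<longleftrightarrow> y - y0 = T y *v \<eta>"
    using cm by (auto simp: coordinate_map_def)
  \<comment> \<open>The preimage is taken under \<open>chi1\<close>, whose continuity is known; it
    allows the uniqueness clause of \<open>chi\<close> to be applied to the point
    \<open>chi1 \<eta>\<close>.\<close>
  define N where "N = U \<inter> (U1 \<inter> chi1 -` V)"
  have "open N"
    unfolding N_def using C1[of 0] U U1 by (intro open_Int continuous_open_preimage) auto
  moreover have "chi1 0 = y0"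
    using U1_eq[OF U1(2,3)] by simp
  then have "0 \<in> N"
    using U U1 by (simp add: N_def)
  moreover have eq: "chi1 \<eta> = chi \<eta>" if "\<eta> \<in> N" for \<eta>
    using U_eq[of \<eta> "chi1 \<eta>"] U1_eq[of \<eta> "chi1 \<eta>"] U1(4)[of \<eta>] that by (simp add: N_def)
  moreover have "chi ` N \<subseteq> W"
    using eq U1(4) \<open>V1 \<subseteq> W\<close> by (force simp: N_def)
  moreover have "smooth_on N chi"
    unfolding smooth_on_def
    by (intro allI C_on_cong[OF \<open>open N\<close> eq] C_on_subset[OF C1]) (auto simp: N_def)
  ultimately show ?thesis
    using that by (auto simp: N_def)
qed

text \<open>The hypothesis \<open>span\<close> is all that is kept of the first integrals; what
  remains is a statement about one frame and one curve.\<close>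

lemma scheme_step_local_error:
  fixes T :: "real ^ 'm \<Rightarrow> real ^ 'k ^ 'm"
  assumes f: "smooth_on UNIV f" and W: "open W" "y t \<in> W" and T: "smooth_on W T"
    and det: "\<And>z. z \<in> W \<Longrightarrow> det (transpose (T z) ** T z) \<noteq> 0"
    and y: "t < b" "ode_solution f y {t..b}"
    and span: "\<And>s. s \<in> {t..b} \<Longrightarrow> y s \<in> W \<Longrightarrow> y s - y t \<in> span (columns (T (y s)))"
    and cm: "coordinate_map (y t) T U V chi"
    and \<Phi>: "method_of_order \<Phi> p"
  shows "\<forall>\<^sub>F h in at_right 0. scheme_coordinate \<Phi> f T chi h \<in> U"
    and "(\<lambda>h. norm (y (t + h) - scheme_step \<Phi> f T chi h)) \<in> O[at_right 0](\<lambda>h. h ^ (p + 1))"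
proof -
  obtain N where N: "open N" "0 \<in> N" "N \<subseteq> U" "chi ` N \<subseteq> W" "smooth_on N chi"
    using smooth_coordinate_map_near_0[OF W T cm] .
  have V: "open V" "y t \<in> V" "\<And>\<eta> z. \<eta> \<in> U \<Longrightarrow> z \<in> V \<Longrightarrow> chi \<eta> = z \<longleftrightarrow> z - y t = T z *v \<eta>"
    using cm by (auto simp: coordinate_map_def)
  \<comment> \<open>The least-squares coordinate of \<open>z\<close>, formed on the open set
    \<open>W\<close> and not only along the curve, so that its smoothness can be combined with the
    chain rule for \<open>y\<close>.\<close>
  define E where "E z = matrix_inv (transpose (T z) ** T z) *v (transpose (T z) *v (z - y t))" for z
  have "C_on n W T" for n
    using T by (simp add: smooth_on_def)
  then have E: "C_on n W E" for n
    unfolding E_def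
    by (intro C_on_matrix_inv_mult C_on_diff C_on_ident C_on_const W(1) det
        bounded_linear.C_on[OF bounded_linear_transpose]
        bounded_bilinear.C_on[OF bounded_bilinear_matrix_vector_mult]
        bounded_bilinear.C_on[OF bounded_bilinear_matrix_matrix_mult])
  have E0: "E (y t) = 0"
    by (simp add: E_def)
  \<comment> \<open>Three demands on a point: \<open>V\<close> for uniqueness of the implicit
    solution, \<open>W\<close> for a smooth frame, and a coordinate in \<open>N\<close>, where
    \<open>chi\<close> is smooth.\<close>
  define Q where "Q = V \<inter> (W \<inter> E -` N)"
  have "open Q"
    unfolding Q_def using E[of 0] W V N by (intro open_Int continuous_open_preimage) auto
  have "y t \<in> Q"
    using E0 W V N by (simp add: Q_def)
  have ysol: "(y has_vector_derivative f (y s)) (at s within {t..b})" if "s \<in> {t..b}" for s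
    using y(2) that by (simp add: ode_solution_def)
  obtain d where d: "d > 0" "\<And>s. s \<in> {t..b} \<Longrightarrow> dist s t < d \<Longrightarrow> y s \<in> Q"
  proof -
    have "continuous (at t within {t..b}) y"
      using has_vector_derivative_continuous[OF ysol] y(1) by simp
    then have "\<forall>\<^sub>F s in at t within {t..b}. y s \<in> Q"
      using topological_tendstoD[OF _ \<open>open Q\<close> \<open>y t \<in> Q\<close>] by (simp add: continuous_within)
    then show ?thesis
      using that \<open>y t \<in> Q\<close> unfolding eventually_at by metis
  qed
  \<comment> \<open>Halving \<open>d\<close> keeps the whole closed interval at distance less than
    \<open>d\<close> from \<open>t\<close>; \<open>method_of_order\<close> asks for a closed
    interval.\<close>
  define b' where "b' = min b (t + d / 2)"
  have b': "t < b'" "{t..b'} \<subseteq> {t..b}"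
    using y(1) d(1) by (auto simp: b'_def)
  have yQ: "y s \<in> Q" if "s \<in> {t..b'}" for s
    using d that by (auto simp: b'_def dist_real_def)
  define \<eta> where "\<eta> s = E (y s)" for s
  have \<eta>N: "\<eta> s \<in> N" if "s \<in> {t..b'}" for s
    using yQ[OF that] by (simp add: Q_def \<eta>_def)
  \<comment> \<open>The span condition makes the least-squares solution exact; uniqueness in
    \<open>V\<close> then identifies \<open>y s\<close> with \<open>chi (\<eta> s)\<close>.\<close>
  have T\<eta>: "y s = y t + T (y s) *v \<eta> s" if "s \<in> {t..b'}" for s
    using gram_solve_span_columns[OF det span] yQ[OF that] that b'(2)
    unfolding \<eta>_def E_def Q_def by (simp add: subset_iff)
  have chi\<eta>: "chi (\<eta> s) = y s" if "s \<in> {t..b'}" for s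
    using V(3)[of "\<eta> s" "y s"] T\<eta>[OF that] \<eta>N[OF that] yQ[OF that] N(3)
    by (auto simp: Q_def algebra_simps)
  let ?g = "transformed_field f T chi"
  have \<eta>_sol: "ode_solution ?g \<eta> {t..b'}"
    unfolding ode_solution_def
  proof
    fix s assume s: "s \<in> {t..b'}"
    let ?F = "at s within {t..b'}"
    have ys: "(y has_vector_derivative f (y s)) ?F"
      using has_vector_derivative_within_subset[OF ysol b'(2)] s b'(2) by blast
    have yW: "y s \<in> W"
      using yQ[OF s] by (simp add: Q_def)
    define \<eta>' where "\<eta>' = frechet_derivative E (at (y s)) (f (y s))"
    have "(E has_derivative frechet_derivative E (at (y s))) (at (y s))"
      by (rule C_on_SucD(1)[OF E yW])
    then have \<eta>': "(\<eta> has_vector_derivative \<eta>') ?F"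
      using vector_derivative_diff_chain_within[OF ys has_derivative_at_withinI]
      unfolding \<eta>'_def \<eta>_def o_def by blast
    have T': "(T has_derivative frechet_derivative T (at (y s))) (at (y s))"
      using T C_on_SucD(1)[OF _ yW] unfolding smooth_on_def by blast
    have "((\<lambda>s. T (y s)) has_vector_derivative frechet_derivative T (at (y s)) (f (y s))) ?F"
      using vector_derivative_diff_chain_within[OF ys has_derivative_at_withinI[OF T']]
      by (simp add: o_def)
    then have "((\<lambda>s. y t + T (y s) *v \<eta> s) has_vector_derivative
        T (y s) *v \<eta>' + frechet_derivative T (at (y s)) (f (y s)) *v \<eta> s) ?F"
      using has_vector_derivative_add[OF has_vector_derivative_const
          bounded_bilinear.has_vector_derivative[OF bounded_bilinear_matrix_vector_mult _ \<eta>']]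
      by simp
    then have "(y has_vector_derivative
        T (y s) *v \<eta>' + frechet_derivative T (at (y s)) (f (y s)) *v \<eta> s) ?F"
      by (rule has_vector_derivative_transform[OF s _, rotated]) (rule T\<eta>)
    \<comment> \<open>Both sides are derivatives of \<open>y\<close> at \<open>s\<close> within the
      interval. At the endpoints these are one-sided, and they are unique because
      \<open>t < b'\<close>.\<close>
    then have "f (y s) = T (y s) *v \<eta>' + frechet_derivative T (at (y s)) (f (y s)) *v \<eta> s"
      by (rule vector_derivative_unique_within_closed_interval[OF b'(1), unfolded cbox_interval, OF s ys])
    then have "?g (\<eta> s) = \<eta>'"
      by (intro transformed_field_eq) (simp_all add: chi\<eta>[OF s] det[OF yW] T')
    with \<eta>' show "(\<eta> has_vector_derivative ?g (\<eta> s)) ?F"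
      by simp
  qed
  have \<eta>t: "\<eta> t = 0"
    by (simp add: \<eta>_def E0)
  \<comment> \<open>The order condition is used on \<open>N\<close>, where the transformed field is
    smooth, for the solution \<open>\<eta>\<close> with starting value \<open>0\<close>.\<close>
  have "open N \<and> smooth_on N ?g \<and> t < b' \<and> \<eta> ` {t..b'} \<subseteq> N \<and> ode_solution ?g \<eta> {t..b'}"
    using smooth_on_transformed_field[OF f N(1,5,4) T det] N(1) b'(1) \<eta>N \<eta>_sol by blast
  from \<Phi>[unfolded method_of_order_def, rule_format, OF this]
  have err: "(\<lambda>h. norm (\<eta> (t + h) - \<Phi> ?g h 0)) \<in> O[at_right 0](\<lambda>h. h ^ (p + 1))"
    unfolding \<eta>t .
  obtain r where r: "r > 0" "cball 0 r \<subseteq> N"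
    using N(1,2) open_contains_cball by metis
  obtain C where C: "\<And>u v. u \<in> cball 0 r \<Longrightarrow> v \<in> cball 0 r \<Longrightarrow> norm (chi u - chi v) \<le> C * norm (u - v)"
    using C_on_1_lipschitz_cball[of N chi 0 r] N(5) r(2) unfolding smooth_on_def by metis
  have th: "\<forall>\<^sub>F h in at_right 0. t + h \<in> {t..b'}"
    using b'(1) by (auto simp: eventually_at_right[of 0 1] intro!: exI[of _ "b' - t"])
  have \<eta>lim: "((\<lambda>h. \<eta> (t + h)) \<longlongrightarrow> 0) (at_right 0)"
  proof -
    have "(\<eta> has_vector_derivative ?g (\<eta> t)) (at t within {t..b'})"
      using \<eta>_sol b'(1) by (simp add: ode_solution_def)
    then have "(\<eta> \<longlongrightarrow> 0) (at t within {t..b'})"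
      using has_vector_derivative_continuous \<eta>t by (fastforce simp: continuous_within)
    moreover have "filterlim (\<lambda>h. t + h) (at t within {t..b'}) (at_right 0)"
      unfolding filterlim_at
    proof (intro conjI)
      show "\<forall>\<^sub>F h in at_right 0. t + h \<in> {t..b'} \<and> t + h \<noteq> t"
        using th eventually_at_right_less[of 0] by eventually_elim auto
    qed (auto intro!: tendsto_eq_intros)
    ultimately show ?thesis
      by (rule filterlim_compose)
  qed
  \<comment> \<open>As the exponent \<open>p + 1\<close> is positive, the error bound tends to
    \<open>0\<close> even for \<open>p = 0\<close>. With \<open>\<eta>lim\<close> this drives the
    numerical value to \<open>0\<close>, hence into the ball on which \<open>chi\<close> is
    Lipschitz.\<close>
  have "((\<lambda>h. norm (\<eta> (t + h) - \<Phi> ?g h 0)) \<longlongrightarrow> 0) (at_right 0)"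
  proof -
    obtain K where "\<forall>\<^sub>F h in at_right 0. norm (norm (\<eta> (t + h) - \<Phi> ?g h 0)) \<le> K * norm (h ^ (p + 1))"
      using landau_o.bigE[OF err] by blast
    moreover have "((\<lambda>h::real. K * norm (h ^ (p + 1))) \<longlongrightarrow> 0) (at_right 0)"
      by (auto intro!: tendsto_eq_intros)
    ultimately show ?thesis
      by (rule Lim_null_comparison)
  qed
  then have \<Phi>lim: "((\<lambda>h. \<Phi> ?g h 0) \<longlongrightarrow> 0) (at_right 0)"
    using tendsto_diff[OF \<eta>lim tendsto_norm_zero_cancel] by fastforce
  have ball: "\<forall>\<^sub>F h in at_right 0. \<Phi> ?g h 0 \<in> cball 0 r" "\<forall>\<^sub>F h in at_right 0. \<eta> (t + h) \<in> cball 0 r"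
    using topological_tendstoD[OF \<Phi>lim open_ball, of 0 r] topological_tendstoD[OF \<eta>lim open_ball, of 0 r] r(1)
    by (simp_all add: eventually_mono)
  show "\<forall>\<^sub>F h in at_right 0. scheme_coordinate \<Phi> f T chi h \<in> U"
    using ball(1) by eventually_elim (use r N(3) in \<open>auto simp: scheme_coordinate_def\<close>)
  have "\<forall>\<^sub>F h in at_right 0. norm (norm (y (t + h) - scheme_step \<Phi> f T chi h))
      \<le> C * norm (norm (\<eta> (t + h) - \<Phi> ?g h 0))"
    using ball th
  proof eventually_elim
    case (elim h)
    then show ?case
      using C[of "\<eta> (t + h)" "\<Phi> ?g h 0"] chi\<eta>[of "t + h"]
      by (simp add: scheme_step_def scheme_coordinate_def)
  qed
  then show "(\<lambda>h. norm (y (t + h) - scheme_step \<Phi> f T chi h)) \<in> O[at_right 0](\<lambda>h. h ^ (p + 1))"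
    by (rule landau_o.big_trans[OF bigoI err])
qed

text \<open>Conservation makes the difference of \<open>H\<close> in the discrete gradient identity
  vanish. The base point is the first argument of \<open>G\<close>, as in
  \<open>complement_frame\<close>.\<close>

lemma first_integral_discrete_gradient_orthogonal:
  fixes f :: "'a::euclidean_space \<Rightarrow> 'a"
  assumes "first_integral f H" "discrete_gradient H G" "ode_solution f y {t..b}" "s \<in> {t..b}"
  shows "G (y t) (y s) \<bullet> (y s - y t) = 0"
proof -
  have "(\<lambda>s. H (y s)) constant_on {t..b}"
    using assms(1,3) is_interval_cc unfolding first_integral_def by blast
  then have "H (y s) = H (y t)"
    using assms(4) unfolding constant_on_def by (metis atLeastAtMost_iff order_refl order_trans)
  moreover have "H (y s) - H (y t) = G (y t) (y s) \<bullet> (y s - y t)"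
    using assms(2) by (simp only: discrete_gradient_def)
  ultimately show ?thesis
    by simp
qed

lemma scheme_has_order_complement_frame:
  fixes T :: "real ^ 'm \<Rightarrow> real ^ 'm \<Rightarrow> real ^ 'k ^ 'm"
  assumes f: "smooth_on UNIV f"
    and H: "\<And>i. i < q \<Longrightarrow> first_integral f (H i)"
    and G: "\<And>i. i < q \<Longrightarrow> discrete_gradient (H i) (G i)"
    and T: "\<And>y0. y0 \<in> M \<Longrightarrow> complement_frame q G y0 (T y0)"
    and \<Phi>: "method_of_order \<Phi> p"
  shows "scheme_has_order f M T \<Phi> p"
  unfolding scheme_has_order_def
proof (intro conjI ballI allI impI)
  fix y0 assume "y0 \<in> M"
  then obtain W where "open W" "y0 \<in> W" "C_on 1 W (T y0)"
    using T unfolding complement_frame_def smooth_on_def by blast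
  then show "\<exists>U V chi. coordinate_map y0 (T y0) U V chi"
    using coordinate_map_differentiable by metis
next
  fix y t b U V chi
  assume *: "t < b \<and> ode_solution f y {t..b} \<and> y t \<in> M \<and> coordinate_map (y t) (T (y t)) U V chi"
  then have "complement_frame q G (y t) (T (y t))"
    using T by simp
  then obtain W where W: "open W" "y t \<in> W" "smooth_on W (T (y t))"
    and frame: "\<forall>z\<in>W. independent_family UNIV (\<lambda>j. column j (T (y t) z)) \<and>
      span (columns (T (y t) z)) = orthogonal_comp (span ((\<lambda>i. G i (y t) z) ` {..<q}))"
    unfolding complement_frame_def by (elim exE conjE)
  then have ind: "independent_family UNIV (\<lambda>j. column j (T (y t) z))"
    and span: "span (columns (T (y t) z)) = orthogonal_comp (span ((\<lambda>i. G i (y t) z) ` {..<q}))"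
    if "z \<in> W" for z
    using that by simp_all
  have "y s - y t \<in> span (columns (T (y t) (y s)))" if "s \<in> {t..b}" "y s \<in> W" for s
  proof -
    \<comment> \<open>Orthogonality to the generators extends to their span, whose orthogonal
      complement is the column space of the frame.\<close>
    have "orthogonal (y s - y t) v" if "v \<in> (\<lambda>i. G i (y t) (y s)) ` {..<q}" for v
      using first_integral_discrete_gradient_orthogonal[OF H G, where y = y and t = t and b = b and s = s] * that \<open>s \<in> {t..b}\<close>
      by (auto simp: orthogonal_def inner_commute)
    then show ?thesis
      unfolding span[OF that(2)] orthogonal_comp_def
      using orthogonal_to_span orthogonal_commute by blast
  qed
  then have span': "\<And>s. s \<in> {t..b} \<Longrightarrow> y s \<in> W \<Longrightarrow> y s - y t \<in> span (columns (T (y t) (y s)))" .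
  have sol: "t < b" "ode_solution f y {t..b}" and cm: "coordinate_map (y t) (T (y t)) U V chi"
    using * by simp_all
  show "\<forall>\<^sub>F h in at_right 0. scheme_coordinate \<Phi> f (T (y t)) chi h \<in> U"
    and "(\<lambda>h. norm (y (t + h) - scheme_step \<Phi> f (T (y t)) chi h)) \<in> O[at_right 0](\<lambda>h. h ^ (p + 1))"
    using scheme_step_local_error[where y = y and t = t, OF f W gram_det_nonzero[OF ind] sol span' cm \<Phi>]
    by blast+
qed

text \<open>
  With \<open>q = m\<close> first integrals the vectors \<open>G i (y t) z\<close> still form a basis for \<open>z\<close> near \<open>y t\<close>,
  so \<open>y s - y t\<close>, being orthogonal to all of them, vanishes.
\<close>

lemma trivial_scheme_has_order_full_rank:
  fixes f :: "real ^ 'm \<Rightarrow> real ^ 'm"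
  assumes H: "\<And>i. i < CARD('m) \<Longrightarrow> first_integral f (H i)"
    and G: "\<And>i. i < CARD('m) \<Longrightarrow> discrete_gradient (H i) (G i)"
    and ind: "\<And>y0. y0 \<in> M \<Longrightarrow> independent_family {..<CARD('m)} (\<lambda>i. grad (H i) y0)"
  shows "trivial_scheme_has_order f M p"
  unfolding trivial_scheme_has_order_def
proof (intro allI impI)
  fix y t b
  assume *: "t < b \<and> ode_solution f y {t..b} \<and> y t \<in> M"
  \<comment> \<open>\<open>\<sigma>\<close> relabels the numbers below \<open>CARD('m)\<close> by
    coordinates, so that the discrete gradients become the rows of a square matrix.\<close>
  obtain \<sigma> where \<sigma>: "bij_betw \<sigma> (UNIV :: 'm set) {..<CARD('m)}"
    using ex_bij_betw_finite_nat[of "UNIV :: 'm set"] by (auto simp: atLeast0LessThan)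
  then have \<sigma>_less: "\<sigma> j < CARD('m)" for j
    by (auto dest: bij_betwE)
  define A :: "real ^ 'm \<Rightarrow> real ^ 'm ^ 'm" where "A z = (\<chi> i. G (\<sigma> i) (y t) z)" for z
  have "continuous_on UNIV (\<lambda>z. G (\<sigma> i) (y t) z)" for i
  proof -
    have "continuous_on UNIV (\<lambda>(v, u). G (\<sigma> i) v u)"
      using G[OF \<sigma>_less] by (simp only: discrete_gradient_def)
    then show ?thesis
      using continuous_on_compose2[of UNIV "\<lambda>(v, u). G (\<sigma> i) v u" UNIV "\<lambda>z. (y t, z)"]
        continuous_on_Pair[OF continuous_on_const continuous_on_id, of "UNIV :: (real ^ 'm) set" "y t"]
      by simp
  qed
  then have "C_on 0 UNIV A"
    by (intro C_on_vec[OF open_UNIV, of 0 A]) (simp add: A_def)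
  then have contA: "continuous_on UNIV (\<lambda>z. det (A z))"
    using C_on_det[of UNIV 0 A] by simp
  \<comment> \<open>On the diagonal the discrete gradients are the gradients, whose independence is
    assumed on \<open>M\<close>.\<close>
  have "(\<lambda>i. column i (transpose (A (y t)))) = (\<lambda>i. grad (H (\<sigma> i)) (y t))"
    using G[OF \<sigma>_less] by (simp add: A_def discrete_gradient_def row_def)
  moreover have "independent_family UNIV (\<lambda>i. grad (H (\<sigma> i)) (y t))"
  proof -
    let ?v = "\<lambda>i. grad (H i) (y t)"
    have "inj_on ?v (\<sigma> ` UNIV)" "independent (?v ` \<sigma> ` UNIV)"
      using ind[of "y t"] * \<sigma> by (simp_all add: independent_family_def bij_betw_def)
    then show ?thesis
      using comp_inj_on[OF bij_betw_imp_inj_on[OF \<sigma>], of ?v]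
      by (simp add: independent_family_def image_comp o_def)
  qed
  \<comment> \<open>For a square matrix the Gram determinant is a product of determinants, so the
    criterion for frames yields invertibility of \<open>A (y t)\<close>.\<close>
  ultimately have "det (transpose (transpose (A (y t))) ** transpose (A (y t))) \<noteq> 0"
    by (intro gram_det_nonzero) simp
  then have "det (A (y t)) \<noteq> 0"
    by (simp add: det_mul)
  define Q where "Q = (\<lambda>z. det (A z)) -` (- {0})"
  have "open Q" "y t \<in> Q"
    using open_vimage[OF _ contA] \<open>det (A (y t)) \<noteq> 0\<close> by (auto simp: Q_def)
  have eq: "y s = y t" if "s \<in> {t..b}" "y s \<in> Q" for s
  proof -
    have "A (y s) *v (y s - y t) = 0"
      using first_integral_discrete_gradient_orthogonal[OF H G, OF \<sigma>_less \<sigma>_less, of y t b s] * that(1)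
      by (simp add: vec_eq_iff A_def matrix_vector_mul_component)
    then have "y s - y t = 0"
      using that(2) matrix_left_invertible_ker[of "A (y s)"]
      by (auto simp: Q_def invertible_det_nz[symmetric] invertible_left_inverse)
    then show ?thesis
      by simp
  qed
  have "(y has_vector_derivative f (y t)) (at t within {t..b})"
    using * by (simp add: ode_solution_def)
  then have "(y \<longlongrightarrow> y t) (at t within {t..b})"
    using has_vector_derivative_continuous continuous_within by blast
  then have "\<forall>\<^sub>F s in at t within {t..b}. y s \<in> Q"
    using topological_tendstoD \<open>open Q\<close> \<open>y t \<in> Q\<close> by blast
  then have "\<forall>\<^sub>F s in at_right t. y s \<in> Q"
    using * by (simp add: at_within_Icc_at_right)
  then have "\<forall>\<^sub>F h in at_right 0. y (h + t) \<in> Q"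
    by (simp add: eventually_at_right_to_0[of _ t])
  moreover have "\<forall>\<^sub>F h in at_right 0. t + h \<in> {t..b}"
    using * by (auto simp: eventually_at_right[of 0 1] intro!: exI[of _ "b - t"])
  \<comment> \<open>The solution rests at \<open>y t\<close> for small \<open>h\<close>, so the
    constant \<open>0\<close> serves for every \<open>p\<close>.\<close>
  ultimately have "\<forall>\<^sub>F h in at_right 0. norm (norm (y (t + h) - y t)) \<le> 0 * norm (h ^ (p + 1))"
    by eventually_elim (use eq in \<open>simp add: add.commute\<close>)
  then show "(\<lambda>h. norm (y (t + h) - y t)) \<in> O[at_right 0](\<lambda>h. h ^ (p + 1))"
    by (rule bigoI)
qed

theorem theorem2p6:
  fixes f :: "real ^ 'm \<Rightarrow> real ^ 'm"
    and H :: "nat \<Rightarrow> real ^ 'm \<Rightarrow> real"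
    and G :: "nat \<Rightarrow> real ^ 'm \<Rightarrow> real ^ 'm \<Rightarrow> real ^ 'm"
    and c :: "nat \<Rightarrow> real"
    and T :: "real ^ 'm \<Rightarrow> real ^ 'm \<Rightarrow> real ^ 'k ^ 'm"
    and \<Phi> :: "(real ^ 'k \<Rightarrow> real ^ 'k) \<Rightarrow> real \<Rightarrow> real ^ 'k \<Rightarrow> real ^ 'k"
    and p q :: nat
  assumes "smooth_on UNIV f"
    and "q \<ge> 1"
    and "\<And>i. i < q \<Longrightarrow> first_integral f (H i)"
    and "\<And>i. i < q \<Longrightarrow> discrete_gradient (H i) (G i)"
    and "\<And>y0. y0 \<in> level_set q H c \<Longrightarrow> independent_family {..<q} (\<lambda>i. grad (H i) y0)"
    and "\<And>y0 i. y0 \<in> level_set q H c \<Longrightarrow> i < q \<Longrightarrow> smooth_on UNIV (G i y0)"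
  shows "(CARD('k) + q = CARD('m) \<and>
          (\<forall>y0\<in>level_set q H c. complement_frame q G y0 (T y0)) \<and>
          method_of_order \<Phi> p \<longrightarrow>
            scheme_has_order f (level_set q H c) T \<Phi> p) \<and>
         (q = CARD('m) \<longrightarrow> trivial_scheme_has_order f (level_set q H c) p)"
proof (intro conjI impI)
  assume "CARD('k) + q = CARD('m) \<and> (\<forall>y0\<in>level_set q H c. complement_frame q G y0 (T y0)) \<and>
    method_of_order \<Phi> p"
  then show "scheme_has_order f (level_set q H c) T \<Phi> p"
    by (intro scheme_has_order_complement_frame[OF assms(1,3,4)]) auto
next
  assume "q = CARD('m)"
  then show "trivial_scheme_has_order f (level_set q H c) p"
    using trivial_scheme_has_order_full_rank assms(3-5) by blast
qed

end
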